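(* Let $k, l \geq 2$ be multiplicatively independent integers (i.e. $\log k/\log l \notin \mathbb{Q}$). Let $a$ be a $k$-automatic sequence and let $b$ be an $l$-automatic sequence (taking values in a finite set). If $a$ and $b$ coincide almost everywhere, then they are both periodic almost everywhere.
   Context: For $A \subset \mathbb{N}_0$, the upper density is $\bar d(A) = \limsup_{n\to\infty} |A \cap [0,n)|/n$. Two sequences $a, b$ coincide almost everywhere if the set $\{n : a(n) \neq b(n)\}$ has upper density $0$. A sequence is periodic almost everywhere if it coincides almost everywhere with some periodic sequence. A sequence is $k$-automatic if $a(n)$ is the output of a deterministic finite automaton with output reading the base-$k$ digits of $n$. *)

theory Defs
  imports "HOL-Library.Extended_Real"
begin

definition upper_density :: "nat set \<Rightarrow> ereal" where
  "upper_density A = limsup (\<lambda>n. ereal (real (card (A \<inter> {0..<n})) / real n))"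

definition coincide_ae :: "(nat \<Rightarrow> 'b) \<Rightarrow> (nat \<Rightarrow> 'b) \<Rightarrow> bool" where
  "coincide_ae a b \<longleftrightarrow> upper_density {n. a n \<noteq> b n} = 0"

definition periodic :: "(nat \<Rightarrow> 'b) \<Rightarrow> bool" where
  "periodic a \<longleftrightarrow> (\<exists>p>0. \<forall>n. a (n + p) = a n)"

definition periodic_ae :: "(nat \<Rightarrow> 'b) \<Rightarrow> bool" where
  "periodic_ae a \<longleftrightarrow> (\<exists>c. periodic c \<and> coincide_ae a c)"

definition multiplicatively_independent :: "nat \<Rightarrow> nat \<Rightarrow> bool" where
  "multiplicatively_independent k l \<longleftrightarrow> ln (real k) / ln (real l) \<notin> \<rat>"

(* Most significant digit first, without leading zeros; the expansion of 0 is the empty word.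
   The guard k < 2 only serves termination. *)
function expansion :: "nat \<Rightarrow> nat \<Rightarrow> nat list" where
  "expansion k n = (if k < 2 \<or> n = 0 then [] else expansion k (n div k) @ [n mod k])"
  by pat_completeness auto
termination by (relation "measure snd") auto

declare expansion.simps [simp del]

lemma expansion_value:
  assumes "k \<ge> 2"
  shows "foldl (\<lambda>x d. k * x + d) 0 (expansion k n) = n"
  using assms
  by (induction k n rule: expansion.induct) (subst expansion.simps, auto)

lemma expansion_digits:
  assumes "k \<ge> 2"
  shows "set (expansion k n) \<subseteq> {..<k}"
  using assms
  by (induction k n rule: expansion.induct) (subst expansion.simps, auto)

lemma hd_expansion_nonzero:
  assumes "k \<ge> 2" and "n > 0"
  shows "expansion k n \<noteq> [] \<and> hd (expansion k n) \<noteq> 0"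
  using assms
proof (induction k n rule: expansion.induct)
  case (1 k n)
  show ?case
  proof (cases "n < k")
    case True
    then show ?thesis
      using 1(2,3) by (simp add: expansion.simps[of k n] expansion.simps[of k 0])
  next
    case False
    with 1 have "n div k > 0"
      by (simp add: div_greater_zero_iff)
    with 1 show ?thesis
      by (subst (1 2) expansion.simps) (auto simp: hd_append)
  qed
qed

(* The output alphabet is the image of the finite state set under the output map. *)
record ('s, 'b) dfao =
  states :: "'s set"
  init :: 's
  trans :: "'s \<Rightarrow> nat \<Rightarrow> 's"
  out :: "'s \<Rightarrow> 'b"

definition is_dfao :: "nat \<Rightarrow> ('s, 'b) dfao \<Rightarrow> bool" where
  "is_dfao k M \<longleftrightarrow> finite (states M) \<and> init M \<in> states M \<and>
     (\<forall>s\<in>states M. \<forall>d<k. trans M s d \<in> states M)"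

definition dfao_output :: "('s, 'b) dfao \<Rightarrow> nat list \<Rightarrow> 'b" where
  "dfao_output M w = out M (foldl (trans M) (init M) w)"

(* States are named by natural numbers, which is no restriction: see automaticI. *)
definition automatic :: "nat \<Rightarrow> (nat \<Rightarrow> 'b) \<Rightarrow> bool" where
  "automatic k a \<longleftrightarrow>
     (\<exists>M :: (nat, 'b) dfao. is_dfao k M \<and> (\<forall>n. a n = dfao_output M (expansion k n)))"

lemma automaticI:
  fixes M :: "('s, 'b) dfao"
  assumes k: "k \<ge> 2" and M: "is_dfao k M" and a: "\<And>n. a n = dfao_output M (expansion k n)"
  shows "automatic k a"
proof -
  have fin: "finite (states M)" and ini: "init M \<in> states M"
    and tr: "\<And>s d. s \<in> states M \<Longrightarrow> d < k \<Longrightarrow> trans M s d \<in> states M"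
    using M by (auto simp: is_dfao_def)
  obtain f :: "'s \<Rightarrow> nat" where f: "inj_on f (states M)"
    using finite_imp_inj_to_nat_seg[OF fin] by blast
  define g where "g = inv_into (states M) f"
  have gf: "g (f s) = s" if "s \<in> states M" for s
    using f that by (simp add: g_def)
  define N :: "(nat, 'b) dfao" where
    "N = \<lparr>states = f ` states M, init = f (init M),
          trans = (\<lambda>s d. f (trans M (g s) d)), out = (\<lambda>s. out M (g s))\<rparr>"
  have N: "is_dfao k N"
    using fin ini tr gf by (auto simp: is_dfao_def N_def)
  have run: "foldl (trans N) (f s) w = f (foldl (trans M) s w) \<and> foldl (trans M) s w \<in> states M"
    if "s \<in> states M" "set w \<subseteq> {..<k}" for s w
    using that by (induction w arbitrary: s) (auto simp: N_def gf tr)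
  have "a n = dfao_output N (expansion k n)" for n
    using run[OF ini expansion_digits[OF k]] a[of n] gf
    by (auto simp: dfao_output_def N_def)
  with N show ?thesis
    by (auto simp: automatic_def)
qed

end

theory Submission
  imports Defs "HOL-Analysis.Kronecker_Approximation_Theorem"
begin

text \<open>
  Call a state essential if the numbers leading to it do not have density zero; almost every number
  has essential prefixes of any fixed colength. Choose K large and then l^j = K k^m + g with g tiny
  compared with k^m. An essential k-state recurs at some x and x + K u, with bounded u, such that
  the surrounding blocks of length l^j also have equal l-states. Comparing the shift of a by
  u K k^m with the shift of b by u l^j shows that the blocks of length k^m of this state have period
  u g. All these periods divide one P < k^m, so a(n + P) = a(n) for almost every n.

  Grouping terms into words of length P reduces the rest to P = 1. Then a sequence is constant on
  every cylinder [x k^m, (x+1) k^m) with x essential, and the values are periodic in m once m is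
  large. Since the quotients of powers of k and l are dense, cylinders for a and for b can be made
  to overlap in a positive proportion at arbitrarily large scales, so all their values agree.
\<close>

section \<open>Sets of density zero\<close>

text \<open>Vanishing upper density in epsilon form with the denominator cleared, so that later
  estimates compare real counts.\<close>

definition density_zero :: "nat set \<Rightarrow> bool" where
  "density_zero S \<longleftrightarrow> (\<forall>\<epsilon>>0. \<forall>\<^sub>F n in sequentially. real (card (S \<inter> {..<n})) \<le> \<epsilon> * real n)"

lemma upper_density_eq_0_iff: "upper_density S = 0 \<longleftrightarrow> density_zero S"
proof
  assume *: "upper_density S = 0"
  show "density_zero S"
    unfolding density_zero_def
  proof (intro allI impI)
    fix \<epsilon> :: real assume "\<epsilon> > 0"
    then have "limsup (\<lambda>n. ereal (real (card (S \<inter> {0..<n})) / real n)) < ereal \<epsilon>"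
      using * by (simp add: upper_density_def)
    then have "\<forall>\<^sub>F n in sequentially. ereal (real (card (S \<inter> {0..<n})) / real n) < ereal \<epsilon>"
      by (rule Limsup_lessD)
    then show "\<forall>\<^sub>F n in sequentially. real (card (S \<inter> {..<n})) \<le> \<epsilon> * real n"
      using eventually_gt_at_top[of 0]
      by eventually_elim (simp add: lessThan_atLeast0 pos_divide_less_eq)
  qed
next
  assume *: "density_zero S"
  have "upper_density S \<le> ereal \<epsilon>" if "\<epsilon> > 0" for \<epsilon> :: real
  proof -
    have "\<forall>\<^sub>F n in sequentially. real (card (S \<inter> {..<n})) \<le> \<epsilon> * real n"
      using * that by (auto simp: density_zero_def)
    then have "\<forall>\<^sub>F n in sequentially. ereal (real (card (S \<inter> {0..<n})) / real n) \<le> ereal \<epsilon>"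
      using eventually_gt_at_top[of 0]
      by eventually_elim (simp add: lessThan_atLeast0 pos_divide_le_eq)
    then show ?thesis
      unfolding upper_density_def by (rule Limsup_bounded)
  qed
  then have "upper_density S \<le> 0"
    by - (rule ereal_le_epsilon2, simp)
  moreover have "0 \<le> upper_density S"
    unfolding upper_density_def by (intro le_Limsup) (auto intro!: always_eventually)
  ultimately show "upper_density S = 0"
    by simp
qed

lemma coincide_ae_iff: "coincide_ae a b \<longleftrightarrow> density_zero {n. a n \<noteq> b n}"
  by (simp add: coincide_ae_def upper_density_eq_0_iff)

lemma density_zero_subset:
  assumes "density_zero T" "S \<subseteq> T"
  shows "density_zero S"
proof -
  have "card (S \<inter> {..<n}) \<le> card (T \<inter> {..<n})" for n
    using assms by (intro card_mono) auto
  then have "real (card (S \<inter> {..<n})) \<le> x" if "real (card (T \<inter> {..<n})) \<le> x" for n x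
    using that by (meson of_nat_le_iff order_trans)
  then show ?thesis
    using assms(1) unfolding density_zero_def by (blast intro: eventually_mono)
qed

lemma density_zero_empty [simp]: "density_zero {}"
  by (auto simp: density_zero_def)

lemma density_zero_Un:
  assumes "density_zero S" "density_zero T"
  shows "density_zero (S \<union> T)"
  unfolding density_zero_def
proof (intro allI impI)
  fix \<epsilon> :: real assume "\<epsilon> > 0"
  then have "\<epsilon> / 2 > 0" by simp
  with assms have "\<forall>\<^sub>F n in sequentially. real (card (S \<inter> {..<n})) \<le> \<epsilon>/2 * real n"
    "\<forall>\<^sub>F n in sequentially. real (card (T \<inter> {..<n})) \<le> \<epsilon>/2 * real n"
    unfolding density_zero_def by blast+
  then show "\<forall>\<^sub>F n in sequentially. real (card ((S \<union> T) \<inter> {..<n})) \<le> \<epsilon> * real n"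
  proof eventually_elim
    case (elim n)
    have "card ((S \<union> T) \<inter> {..<n}) \<le> card (S \<inter> {..<n}) + card (T \<inter> {..<n})"
      by (simp add: Int_Un_distrib2 card_Un_le)
    then have "real (card ((S \<union> T) \<inter> {..<n})) \<le> real (card (S \<inter> {..<n})) + real (card (T \<inter> {..<n}))"
      by linarith
    with elim show ?case by (simp add: field_simps)
  qed
qed

lemma density_zero_UN:
  assumes "finite I" "\<And>i. i \<in> I \<Longrightarrow> density_zero (S i)"
  shows "density_zero (\<Union>i\<in>I. S i)"
  using assms by (induction I rule: finite_induct) (auto intro: density_zero_Un)

lemma not_density_zeroE:
  assumes "\<not> density_zero S"
  obtains \<delta> :: real where "\<delta> > 0" "\<exists>\<^sub>F n in sequentially. \<delta> * real n < real (card (S \<inter> {..<n}))"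
  using assms by (auto simp: density_zero_def not_eventually not_le)

lemma density_zero_lessThan: "density_zero {..<N::nat}"
  unfolding density_zero_def
proof (intro allI impI)
  fix \<epsilon> :: real assume "\<epsilon> > 0"
  have "\<forall>\<^sub>F n in sequentially. real n \<ge> real N / \<epsilon>"
    using filterlim_real_sequentially by (simp add: filterlim_at_top)
  then show "\<forall>\<^sub>F n in sequentially. real (card ({..<N} \<inter> {..<n})) \<le> \<epsilon> * real n"
  proof eventually_elim
    case (elim n)
    have "card ({..<N} \<inter> {..<n}) \<le> card {..<N}"
      by (intro card_mono) auto
    then have "real (card ({..<N} \<inter> {..<n})) \<le> real N" by simp
    also have "\<dots> \<le> \<epsilon> * real n"
      using elim \<open>\<epsilon> > 0\<close> by (simp add: field_simps)
    finally show ?case .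
  qed
qed

text \<open>The injection x -> x q + r maps numbers below n to numbers below n (q + r), so the range
  of counting grows only by a constant factor, which \<open>\<epsilon>'\<close> absorbs.\<close>

lemma density_zero_affine_vimage:
  assumes "density_zero S" "q > 0"
  shows "density_zero {x. x * q + r \<in> S}"
  unfolding density_zero_def
proof (intro allI impI)
  fix \<epsilon> :: real assume "\<epsilon> > 0"
  define \<epsilon>' where "\<epsilon>' = \<epsilon> / real (q + r)"
  have "\<epsilon>' > 0" using \<open>\<epsilon> > 0\<close> assms(2) by (simp add: \<epsilon>'_def)
  with assms(1) obtain N where N: "\<And>n. n \<ge> N \<Longrightarrow> real (card (S \<inter> {..<n})) \<le> \<epsilon>' * real n"
    by (auto simp: density_zero_def eventually_at_top_linorder)
  have "real (card ({x. x * q + r \<in> S} \<inter> {..<n})) \<le> \<epsilon> * real n" if n: "n \<ge> max N 1" for n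
  proof -
    have "card ({x. x * q + r \<in> S} \<inter> {..<n}) = card ((\<lambda>x. x * q + r) ` ({x. x * q + r \<in> S} \<inter> {..<n}))"
      using assms(2) by (intro card_image [symmetric]) (auto simp: inj_on_def)
    also have "\<dots> \<le> card (S \<inter> {..<n * (q + r)})"
    proof (intro card_mono)
      have "x * q + r < n * (q + r)" if "x < n" for x
      proof -
        have "x * q < n * q" "r \<le> n * r"
          using that assms(2) n by auto
        then show ?thesis
          unfolding distrib_left by linarith
      qed
      then show "(\<lambda>x. x * q + r) ` ({x. x * q + r \<in> S} \<inter> {..<n}) \<subseteq> S \<inter> {..<n * (q + r)}"
        by auto
    qed auto
    finally have "real (card ({x. x * q + r \<in> S} \<inter> {..<n})) \<le> real (card (S \<inter> {..<n * (q + r)}))"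
      by simp
    also have "\<dots> \<le> \<epsilon>' * real (n * (q + r))"
    proof (rule N)
      have "n * 1 \<le> n * (q + r)"
        using assms(2) by (intro mult_le_mono2) auto
      with n show "N \<le> n * (q + r)"
        by linarith
    qed
    also have "\<dots> = \<epsilon> * real n"
      using assms(2) by (simp add: \<epsilon>'_def)
    finally show ?thesis .
  qed
  then show "\<forall>\<^sub>F n in sequentially. real (card ({x. x * q + r \<in> S} \<inter> {..<n})) \<le> \<epsilon> * real n"
    unfolding eventually_at_top_linorder by blast
qed

lemma density_zero_affine_image:
  assumes "density_zero S" "q > 0"
  shows "density_zero ((\<lambda>x. x * q + r) ` S)"
  unfolding density_zero_def
proof (intro allI impI)
  fix \<epsilon> :: real assume "\<epsilon> > 0"
  with assms(1) have "\<forall>\<^sub>F n in sequentially. real (card (S \<inter> {..<n})) \<le> \<epsilon> * real n"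
    by (auto simp: density_zero_def)
  then show "\<forall>\<^sub>F n in sequentially. real (card ((\<lambda>x. x * q + r) ` S \<inter> {..<n})) \<le> \<epsilon> * real n"
  proof eventually_elim
    case (elim n)
    have le: "x \<le> x * q + r" for x
      using assms(2) by (simp add: trans_le_add1)
    have "(\<lambda>x. x * q + r) ` S \<inter> {..<n} \<subseteq> (\<lambda>x. x * q + r) ` (S \<inter> {..<n})"
      using le by (fastforce intro: le_less_trans)
    then have "card ((\<lambda>x. x * q + r) ` S \<inter> {..<n}) \<le> card (S \<inter> {..<n})"
      by (intro surj_card_le) auto
    with elim show ?case by linarith
  qed
qed

text \<open>Sorting n by its remainder mod q gives q affine images of S. This turns negligible sets
  of prefixes into negligible sets of numbers.\<close>

lemma density_zero_div_vimage:
  assumes "density_zero S" "q > 0"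
  shows "density_zero {n. n div q \<in> S}"
proof (rule density_zero_subset)
  show "density_zero (\<Union>r\<in>{..<q}. (\<lambda>x. x * q + r) ` S)"
    using assms by (intro density_zero_UN density_zero_affine_image) auto
  have "n \<in> (\<lambda>x. x * q + n mod q) ` S \<and> n mod q < q" if "n div q \<in> S" for n
    using that assms(2) by (auto intro!: image_eqI[of _ _ "n div q"])
  then show "{n. n div q \<in> S} \<subseteq> (\<Union>r\<in>{..<q}. (\<lambda>x. x * q + r) ` S)"
    by blast
qed

text \<open>One affine preimage per offset r. The windows may overlap, since M is not bounded by
  q.\<close>

lemma density_zero_meeting_windows:
  assumes "density_zero D" "q > 0"
  shows "density_zero {x. \<exists>r<M. x * q + r \<in> D}"
proof -
  have "{x. \<exists>r<M. x * q + r \<in> D} = (\<Union>r\<in>{..<M}. {x. x * q + r \<in> D})"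
    by auto
  then show ?thesis
    using assms by (auto intro!: density_zero_UN density_zero_affine_vimage)
qed

text \<open>The minimum of finitely many densities works; the good n are only frequent and may
  differ with i. A common \<delta> allows K, U and the period to be chosen before any state is
  fixed.\<close>

lemma uniform_density_of_finitely_many:
  assumes "finite I" "\<And>i. i \<in> I \<Longrightarrow> \<not> density_zero (S i)"
  obtains \<delta> :: real where "\<delta> > 0"
    "\<And>i. i \<in> I \<Longrightarrow> \<exists>\<^sub>F n in sequentially. \<delta> * real n < real (card (S i \<inter> {..<n}))"
proof -
  have "\<exists>\<delta>>0::real. \<forall>i\<in>I. \<exists>\<^sub>F n in sequentially. \<delta> * real n < real (card (S i \<inter> {..<n}))"
    using assms
  proof (induction I rule: finite_induct)
    case empty
    then show ?case by (auto intro: exI[of _ 1])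
  next
    case (insert i I)
    then obtain \<delta> :: real where \<delta>: "\<delta> > 0"
      "\<And>i. i \<in> I \<Longrightarrow> \<exists>\<^sub>F n in sequentially. \<delta> * real n < real (card (S i \<inter> {..<n}))"
      by auto
    obtain \<delta>' :: real where \<delta>': "\<delta>' > 0" "\<exists>\<^sub>F n in sequentially. \<delta>' * real n < real (card (S i \<inter> {..<n}))"
      using insert.prems not_density_zeroE by blast
    have less: "min \<delta> \<delta>' * real n < t" if "\<delta> * real n < t \<or> \<delta>' * real n < t" for n t
      using that by (meson le_less_trans min.cobounded1 min.cobounded2 mult_right_mono of_nat_0_le_iff)
    have "\<exists>\<^sub>F n in sequentially. min \<delta> \<delta>' * real n < real (card (S j \<inter> {..<n}))"
      if "j \<in> insert i I" for j
      proof (cases "j = i")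
      case True
      show ?thesis
        unfolding True using \<delta>'(2) by (rule frequently_elim1) (simp add: less)
    next
      case False
      with that have "j \<in> I" by simp
      from \<delta>(2)[OF this] show ?thesis
        by (rule frequently_elim1) (simp add: less)
    qed
    with \<delta>(1) \<delta>'(1) show ?case
      by (intro exI[of _ "min \<delta> \<delta>'"]) auto
  qed
  then show thesis
    using that by blast
qed

section \<open>Powers of multiplicatively independent integers\<close>

text \<open>In logarithms to base l, an integer j is wanted between m \<theta> + \<alpha>' and m
  \<theta> + \<beta>'. As \<theta> is irrational, the fractional parts of its multiples are
  dense.\<close>

lemma power_ratio_dense:
  fixes \<alpha> \<beta> :: real
  assumes "k \<ge> 2" "l \<ge> 2" "multiplicatively_independent k l" "0 < \<alpha>" "\<alpha> < \<beta>"
  obtains m j where "m \<ge> M" "\<alpha> * real k ^ m < real l ^ j" "real l ^ j < \<beta> * real k ^ m"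
proof -
  define \<theta> where "\<theta> = ln (real k) / ln (real l)"
  have lnk: "ln (real k) > 0" and lnl: "ln (real l) > 0"
    using assms(1,2) by auto
  then have \<theta>: "\<theta> > 0" "\<theta> \<notin> \<rat>"
    using assms(3) by (auto simp: \<theta>_def multiplicatively_independent_def)
  define \<alpha>' \<beta>' where "\<alpha>' = ln \<alpha> / ln (real l)" and "\<beta>' = ln \<beta> / ln (real l)"
  have "\<alpha>' < \<beta>'"
    using assms(4,5) lnl by (simp add: \<alpha>'_def \<beta>'_def divide_strict_right_mono)
  \<comment> \<open>Taking m at least M' makes the lower end of the interval positive, so that the
    integer h found below is a natural number.\<close>
  obtain M' where M': "real M' > - \<alpha>' / \<theta>"
    using reals_Archimedean2 by blast
  define N where "N = max M M'"
  have N: "real N * \<theta> + \<alpha>' > 0"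
  proof -
    have "real N > - \<alpha>' / \<theta>"
      using M' by (simp add: N_def max_def)
    then show ?thesis
      using \<theta>(1) by (simp add: field_simps)
  qed
  \<comment> \<open>The target is chosen so that h lies within half the interval length of the
    midpoint of the interval for m = N + q.\<close>
  obtain h q where q: "q > 0" and hq:
    "\<bar>of_int q * \<theta> - of_int h - (- (\<alpha>' + \<beta>') / 2 - real N * \<theta>)\<bar> < (\<beta>' - \<alpha>') / 2"
    by (rule sequence_of_fractional_parts_is_dense[OF \<theta>(2), of "(\<beta>' - \<alpha>') / 2" "- (\<alpha>' + \<beta>') / 2 - real N * \<theta>"])
      (use \<open>\<alpha>' < \<beta>'\<close> in auto)
  define m where "m = N + nat q"
  have m: "real m = real N + of_int q"
    using q by (simp add: m_def)
  have 1: "real m * \<theta> + \<alpha>' < of_int h" and 2: "of_int h < real m * \<theta> + \<beta>'"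
    using hq unfolding m distrib_right by argo+
  have "real N * \<theta> \<le> real m * \<theta>"
    using \<theta>(1) by (intro mult_right_mono) (auto simp: m_def)
  then have "h > 0"
    using 1 N by linarith
  define j where "j = nat h"
  have j: "of_int h = real j"
    using \<open>h > 0\<close> by (simp add: j_def)
  have ln_pow: "ln (c * real k ^ m) = (real m * \<theta> + ln c / ln (real l)) * ln (real l)" if "c > 0" for c
    using that assms(1) lnl by (simp add: ln_mult ln_realpow \<theta>_def field_simps)
  have lnj: "ln (real l ^ j) = real j * ln (real l)"
    using assms(2) by (simp add: ln_realpow)
  have "ln (\<alpha> * real k ^ m) < ln (real l ^ j)" "ln (real l ^ j) < ln (\<beta> * real k ^ m)"
    using 1 2 lnl assms(4,5) unfolding j
    by (subst lnj, subst ln_pow; simp add: \<alpha>'_def \<beta>'_def)+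
  then have "\<alpha> * real k ^ m < real l ^ j" "real l ^ j < \<beta> * real k ^ m"
    using assms by (auto simp: ln_less_cancel_iff)
  then show thesis
    using that[of m j] by (simp add: m_def N_def)
qed

section \<open>Digit states\<close>

text \<open>
  The digits r appended to x may exceed k^m by the factor w, so that for w = 2 the state of x also
  controls the block after x and periods can be followed across a block boundary.
\<close>
definition digit_states :: "nat \<Rightarrow> nat \<Rightarrow> (nat \<Rightarrow> 's) \<Rightarrow> (nat \<Rightarrow> 'b) \<Rightarrow> bool" where
  "digit_states k w A a \<longleftrightarrow> finite (range A) \<and>
     (\<forall>x x' m r. A x = A x' \<longrightarrow> r < w * k ^ m \<longrightarrow> a (x * k ^ m + r) = a (x' * k ^ m + r))"

lemma digit_statesI:
  assumes "finite (range A)"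
    and "\<And>x x' m r. A x = A x' \<Longrightarrow> r < w * k ^ m \<Longrightarrow> a (x * k ^ m + r) = a (x' * k ^ m + r)"
  shows "digit_states k w A a"
  using assms unfolding digit_states_def by blast

lemma digit_statesD:
  assumes "digit_states k w A a" "A x = A x'" "r < w * k ^ m"
  shows "a (x * k ^ m + r) = a (x' * k ^ m + r)"
  using assms unfolding digit_states_def by blast

text \<open>The word w is fixed before x: it is r written with m digits, leading zeros included. At
  x = 0 those zeros would be dropped, hence x > 0.\<close>

lemma expansion_append:
  assumes "k \<ge> 2" "r < k ^ m"
  shows "\<exists>w. set w \<subseteq> {..<k} \<and> (\<forall>x>0. expansion k (x * k ^ m + r) = expansion k x @ w)"
  using assms(2)
proof (induction m arbitrary: r)
  case 0
  then show ?case by (intro exI[of _ "[]"]) auto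
next
  case (Suc m)
  have "r div k < k ^ m"
    using Suc.prems by (simp add: less_mult_imp_div_less mult.commute)
  then obtain w where w: "set w \<subseteq> {..<k}"
    "\<And>x. x > 0 \<Longrightarrow> expansion k (x * k ^ m + r div k) = expansion k x @ w"
    using Suc.IH by blast
  have "expansion k (x * k ^ Suc m + r) = expansion k x @ w @ [r mod k]" if "x > 0" for x
  proof -
    have eq: "x * k ^ Suc m + r = r + (x * k ^ m) * k"
      by simp
    have "(x * k ^ Suc m + r) div k = x * k ^ m + r div k" "(x * k ^ Suc m + r) mod k = r mod k"
      unfolding eq using assms(1) by (simp_all only: div_mult_self1 mod_mult_self1)
    then show ?thesis
      using assms(1) that w(2)[OF that] by (subst expansion.simps) auto
  qed
  then show ?case
    using w(1) assms(1) by (intro exI[of _ "w @ [r mod k]"]) auto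
qed

lemma automatic_digit_states:
  fixes a :: "nat \<Rightarrow> 'b"
  assumes "k \<ge> 2" "automatic k a"
  obtains A :: "nat \<Rightarrow> nat option" where "digit_states k 1 A a"
proof -
  obtain M :: "(nat, 'b) dfao" where M: "is_dfao k M" and a: "\<And>n. a n = dfao_output M (expansion k n)"
    using assms(2) by (auto simp: automatic_def)
  have run: "foldl (trans M) s w \<in> states M" if "s \<in> states M" "set w \<subseteq> {..<k}" for s w
    using that M by (induction w arbitrary: s) (auto simp: is_dfao_def)
  \<comment> \<open>Appending digits to 0 loses leading zeros, so 0 gets the separate state
    \<open>None\<close> and is only ever compared with itself.\<close>
  define A where "A x = (if x = 0 then None else Some (foldl (trans M) (init M) (expansion k x)))" for x
  have "range A \<subseteq> insert None (Some ` states M)"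
    using run[OF _ expansion_digits[OF assms(1)]] M by (auto simp: A_def is_dfao_def)
  then have fin: "finite (range A)"
    by (rule finite_subset) (use M in \<open>auto simp: is_dfao_def\<close>)
  have eq: "a (x * k ^ m + r) = a (x' * k ^ m + r)" if "A x = A x'" and r: "r < k ^ m" for x x' m r
  proof -
    obtain w where w: "\<And>x. x > 0 \<Longrightarrow> expansion k (x * k ^ m + r) = expansion k x @ w"
      using expansion_append[OF assms(1) r] by blast
    show ?thesis
      using that(1) w[of x] w[of x'] by (auto simp: A_def a dfao_output_def split: if_splits)
  qed
  have "digit_states k 1 A a"
    by (intro digit_statesI fin eq) simp_all
  then show thesis
    by (rule that)
qed

text \<open>An offset r \<ge> k^m is the offset r - k^m in the block of x + 1, whose state is
  recorded too.\<close>

lemma digit_states_two_blocks: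
  assumes "digit_states k 1 A a"
  shows "digit_states k 2 (\<lambda>x. (A x, A (x + 1))) a"
proof -
  have "range (\<lambda>x. (A x, A (x + 1))) \<subseteq> range A \<times> range A"
    by auto
  then have fin: "finite (range (\<lambda>x. (A x, A (x + 1))))"
    by (rule finite_subset) (use assms in \<open>auto simp: digit_states_def\<close>)
  have eq: "a (x * k ^ m + r) = a (x' * k ^ m + r)"
    if "A x = A x'" "A (x + 1) = A (x' + 1)" "r < 2 * k ^ m" for x x' m r
  proof (cases "r < k ^ m")
    case True
    then show ?thesis
      by (intro digit_statesD[OF assms that(1)]) simp
  next
    case False
    have "a ((x + 1) * k ^ m + (r - k ^ m)) = a ((x' + 1) * k ^ m + (r - k ^ m))"
      using that(3) False by (intro digit_statesD[OF assms that(2)]) (simp add: less_diff_conv2)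
    with False show ?thesis by (simp add: algebra_simps)
  qed
  show ?thesis
    by (intro digit_statesI fin eq) simp_all
qed

text \<open>The index (x k^m + r) P + i equals x P k^m + (r P + i), and r P + i < P k^m. Its prefix
  is therefore x P + t with t < P, so the states of these P prefixes determine the word.\<close>

lemma digit_states_blocking:
  assumes "digit_states k 1 A a" "k \<ge> 1"
  shows "digit_states k 1 (\<lambda>x. map (\<lambda>i. A (x * P + i)) [0..<P]) (\<lambda>n. map (\<lambda>i. a (n * P + i)) [0..<P])"
proof -
  have "range (\<lambda>x. map (\<lambda>i. A (x * P + i)) [0..<P]) \<subseteq> {xs. set xs \<subseteq> range A \<and> length xs = P}"
    by auto
  then have fin: "finite (range (\<lambda>x. map (\<lambda>i. A (x * P + i)) [0..<P]))"
    by (rule finite_subset) (use assms finite_lists_length_eq in \<open>auto simp: digit_states_def\<close>)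
  have eq: "a ((x * k ^ m + r) * P + i) = a ((x' * k ^ m + r) * P + i)"
    if A: "\<And>i. i < P \<Longrightarrow> A (x * P + i) = A (x' * P + i)" and "r < k ^ m" "i < P" for x x' m r i
  proof -
    define t where "t = (r * P + i) div k ^ m"
    have "r * P + i < (r + 1) * P"
      using \<open>i < P\<close> by simp
    also have "\<dots> \<le> k ^ m * P"
      using \<open>r < k ^ m\<close> by (intro mult_right_mono) auto
    finally have t: "t < P"
      unfolding t_def by (simp add: less_mult_imp_div_less mult.commute)
    have split: "(z * k ^ m + r) * P + i = (z * P + t) * k ^ m + (r * P + i) mod k ^ m" for z
    proof -
      have "(z * k ^ m + r) * P + i = z * P * k ^ m + (r * P + i)"
        by (simp add: algebra_simps)
      also have "r * P + i = t * k ^ m + (r * P + i) mod k ^ m"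
        unfolding t_def by (rule div_mult_mod_eq [symmetric])
      finally show ?thesis
        by (simp add: algebra_simps)
    qed
    have "(r * P + i) mod k ^ m < k ^ m"
      using assms(2) by simp
    then show ?thesis
      unfolding split by (intro digit_statesD[OF assms(1)] A[OF t]) simp
  qed
  show ?thesis
    by (intro digit_statesI fin map_cong refl eq) simp_all
qed

section \<open>Periodicity along blocks\<close>

text \<open>Pigeonhole: without such a pair, S has at most one element for each residue mod K,
  window of length K (U + 1) and colour. Up to a constant this leaves n card R / (U + 1) elements
  below n, too few for density \<delta>.\<close>

lemma recurrence_of_coloured_set:
  fixes c :: "nat \<Rightarrow> 'c"
  assumes freq: "\<exists>\<^sub>F n in sequentially. \<delta> * real n < real (card (S \<inter> {..<n}))"
    and \<delta>: "\<delta> > 0" and R: "finite R" "range c \<subseteq> R" and U: "real (card R) < \<delta> / 2 * real (U + 1)"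
    and K: "K > 0"
  obtains x u where "x \<in> S" "x + K * u \<in> S" "c (x + K * u) = c x" "1 \<le> u" "u \<le> U"
proof (rule ccontr)
  note witness = that
  assume no: "\<not> thesis"
  \<comment> \<open>Equal residues make the difference a multiple K u, and a common window forces u
    \<le> U.\<close>
  define f where "f x = (x mod K, x div (K * (U + 1)), c x)" for x
  have less: False if "x < x'" "x \<in> S" "x' \<in> S" "f x = f x'" for x x'
  proof -
    have "x mod K = x' mod K"
      using that by (simp add: f_def)
    then have "K dvd x' - x"
      using \<open>x < x'\<close> by (metis mod_eq_dvd_iff_nat less_imp_le)
    then obtain u where u: "x' - x = K * u" ..
    define W where "W = K * (U + 1)"
    have "W > 0" using K by (simp add: W_def)
    have "x div W = x' div W"
      using that by (simp add: f_def W_def)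
    then have "x' - x < W"
      by (metis \<open>W > 0\<close> add_diff_cancel_left' div_mult_mod_eq mod_less_divisor
          diff_le_self le_less_trans diff_diff_left)
    then have "K * u < K * (U + 1)"
      unfolding u W_def .
    then have "u < U + 1"
      using K by (simp only: mult_less_cancel1)
    then have "u \<le> U"
      by simp
    moreover have "u \<ge> 1"
      using u \<open>x < x'\<close> by (cases u) auto
    moreover have x': "x' = x + K * u"
      using u \<open>x < x'\<close> by simp
    moreover have "c x' = c x"
      using \<open>f x = f x'\<close> by (simp add: f_def)
    ultimately have thesis
      using \<open>x \<in> S\<close> \<open>x' \<in> S\<close> by (intro witness[of x u]) auto
    with no show False ..
  qed
  then have inj: "inj_on f S"
    by (metis inj_onI linorder_neqE_nat)
  have bound: "real (card (S \<inter> {..<n})) \<le> \<delta> / 2 * real n + real K * real (card R)" for n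
  proof -
    have "card (S \<inter> {..<n}) = card (f ` (S \<inter> {..<n}))"
      using inj by (intro card_image [symmetric]) (auto intro: inj_on_subset)
    also have "\<dots> \<le> card ({..<K} \<times> {..n div (K * (U + 1))} \<times> R)"
    proof (rule card_mono)
      show "f ` (S \<inter> {..<n}) \<subseteq> {..<K} \<times> {..n div (K * (U + 1))} \<times> R"
        using K R(2) by (auto simp: f_def intro!: div_le_mono)
    qed (use R in auto)
    also have "\<dots> = K * ((n div (K * (U + 1)) + 1) * card R)"
      by (simp add: card_cartesian_product)
    finally have "real (card (S \<inter> {..<n})) \<le> real K * ((real (n div (K * (U + 1))) + 1) * real (card R))"
      unfolding of_nat_le_iff [symmetric, where ?'a = real] of_nat_mult of_nat_add of_nat_1 .
    also have "\<dots> \<le> real K * ((real n / real (K * (U + 1)) + 1) * real (card R))"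
      by (intro mult_left_mono mult_right_mono add_right_mono of_nat_div_le_of_nat) auto
    also have "\<dots> = real n * (real (card R) / real (U + 1)) + real K * real (card R)"
    proof -
      have "real K * ((real n / (real K * V) + 1) * C) = real n * (C / V) + real K * C"
        if "V > 0" for V C :: real
        using K that by (simp add: field_simps)
      then show ?thesis
        by (simp only: of_nat_mult of_nat_0_less_iff zero_less_Suc Suc_eq_plus1 [symmetric])
    qed
    also have "\<dots> \<le> real n * (\<delta> / 2) + real K * real (card R)"
      using U by (intro add_right_mono mult_left_mono) (auto simp: field_simps)
    finally show ?thesis by (simp add: mult.commute)
  qed
  have "\<forall>\<^sub>F n in sequentially. real n \<ge> 2 * real K * real (card R) / \<delta>"
    using filterlim_real_sequentially by (simp add: filterlim_at_top)
  with freq obtain n where n: "\<delta> * real n < real (card (S \<inter> {..<n}))"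
    "real n \<ge> 2 * real K * real (card R) / \<delta>"
    by (blast dest: frequently_eventually_conj frequently_ex)
  have "real K * real (card R) \<le> \<delta> / 2 * real n"
    using n(2) \<delta> by (simp add: field_simps)
  then show False
    using n(1) bound[of n] by (simp add: field_simps)
qed

text \<open>The points (x + 2) q have spacing q, so at most three of them lie within 3 q after a
  given multiple of L. Since L \<ge> K q, at most (n + 1) div K + 1 multiples matter for x <
  n.\<close>

lemma card_near_multiples:
  assumes "q > 0" "K > 0" "K * q \<le> L"
  shows "card ({x. (x + 2) * q mod L < 3 * q} \<inter> {..<n}) \<le> 3 * ((n + 1) div K + 1)"
proof -
  define f where "f x = ((x + 2) * q div L, (x + 2) * q mod L div q)" for x
  have "inj f"
  proof (rule injI)
    fix x x' assume eq: "f x = f x'"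
    define t where "t = fst (f x) * L + snd (f x) * q"
    have rep: "(z + 2) * q = fst (f z) * L + snd (f z) * q + (z + 2) * q mod L mod q" for z
      by (simp only: f_def fst_conv snd_conv add.assoc div_mult_mod_eq)
    have "t \<le> (z + 2) * q \<and> (z + 2) * q < t + q" if "f z = f x" for z
      using rep[of z] assms(1) unfolding that t_def
      by (metis le_add1 mod_less_divisor nat_add_left_cancel_less)
    from this[of x] this[of x'] have "(x + 2) * q < (x' + 2) * q + q" "(x' + 2) * q < (x + 2) * q + q"
      using eq by auto
    then have "(x + 2) * q < (x' + 3) * q" "(x' + 2) * q < (x + 3) * q"
      by (simp_all add: algebra_simps)
    then have "x + 2 < x' + 3" "x' + 2 < x + 3"
      unfolding mult_less_cancel2 by blast+
    then show "x = x'"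
      by simp
  qed
  then have "card ({x. (x + 2) * q mod L < 3 * q} \<inter> {..<n})
      = card (f ` ({x. (x + 2) * q mod L < 3 * q} \<inter> {..<n}))"
    by (intro card_image [symmetric]) (auto intro: inj_on_subset)
  also have "\<dots> \<le> card ({..(n + 1) div K} \<times> {..<3::nat})"
  proof (rule card_mono)
    have "(x + 2) * q div L \<le> (n + 1) div K" if "x < n" for x
    proof -
      have "(x + 2) * q div L \<le> (x + 2) * q div (K * q)"
        using assms by (intro div_le_mono2) auto
      also have "\<dots> \<le> (n + 1) div K"
        using assms(1) that by (subst div_mult_mult2) (auto intro: div_le_mono)
      finally show ?thesis .
    qed
    then show "f ` ({x. (x + 2) * q mod L < 3 * q} \<inter> {..<n}) \<subseteq> {..(n + 1) div K} \<times> {..<3}"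
      by (auto simp: f_def less_mult_imp_div_less)
  qed auto
  finally show ?thesis
    by (simp add: card_cartesian_product)
qed

lemma period_iterate:
  fixes f :: "nat \<Rightarrow> 'b"
  assumes "\<And>r. r + p < N \<Longrightarrow> f (r + p) = f r"
  shows "r + i * p < N \<Longrightarrow> f (r + i * p) = f r"
proof (induction i)
  case (Suc i)
  then have "f (r + i * p + p) = f (r + i * p)"
    by (intro assms) (simp add: algebra_simps)
  with Suc show ?case
    by (simp add: algebra_simps)
qed auto

text \<open>Around a good x with state s, a agrees with b, and the b-block of x has the same state
  as the one u blocks later. This moves values by u L, whereas the recurrence of s moves them by u K
  q, so u g is a period. As u depends on s and is only known to be at most U,
  \<open>fact U * g\<close> is used as a common multiple.\<close>

lemma local_period:
  fixes a b :: "nat \<Rightarrow> 'b" and A :: "nat \<Rightarrow> 's" and B :: "nat \<Rightarrow> 't"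
  assumes A: "\<And>x x' r. A x = A x' \<Longrightarrow> r < 2 * q \<Longrightarrow> a (x * q + r) = a (x' * q + r)"
    and B: "\<And>y y' r. B y = B y' \<Longrightarrow> r < L \<Longrightarrow> b (y * L + r) = b (y' * L + r)"
    and fin: "finite (range B)" and U: "real (card (range B)) < \<delta> / 4 * real (U + 1)"
    and L: "L = K * q + g" and g: "U * g \<le> q" and q: "q > 0" and K: "24 \<le> \<delta> * real K"
    and D: "density_zero {n. a n \<noteq> b n}"
    and \<delta>: "\<delta> > 0" and freq: "\<exists>\<^sub>F n in sequentially. \<delta> * real n < real (card ({x. A x = s} \<inter> {..<n}))"
    and s: "A z = s" and r: "r + fact U * g < 2 * q"
  shows "a (z * q + r + fact U * g) = a (z * q + r)"
proof -
  have K0: "K > 0"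
    using K \<delta> by (cases K) auto
  then have L0: "L > 0"
    using L q by simp
  \<comment> \<open>For x outside \<open>Bd\<close>, the double block from x q to (x + 2) q lies in
    one block of length L, with a margin q for the later displacement u g.\<close>
  define Bd where "Bd = {x. (x + 2) * q mod L < 3 * q}"
  \<comment> \<open>Long enough to contain the double blocks at x and at x + K u, the latter
    displaced by u g \<le> q.\<close>
  define M where "M = (K * U + 4) * q"
  define Z where "Z = {x. \<exists>r<M. x * q + r \<in> {n. a n \<noteq> b n}}"
  define S where "S = {x. A x = s} - (Bd \<union> Z)"
  \<comment> \<open>The choice K \<ge> 24 / \<delta> gives slope 3 / K \<le> \<delta> / 8; the
    threshold on n absorbs the additive terms. \<open>Bd\<close> and \<open>Z\<close> cost \<delta>
    / 4 each, leaving \<delta> / 2 for \<open>S\<close>.\<close>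
  have Bd_bound: "\<forall>\<^sub>F n in sequentially. real (card (Bd \<inter> {..<n})) \<le> \<delta> / 4 * real n"
  proof -
    have "\<forall>\<^sub>F n in sequentially. real n \<ge> 1 + 24 / \<delta>"
      using filterlim_real_sequentially by (simp add: filterlim_at_top)
    then show ?thesis
    proof eventually_elim
      case (elim n)
      have "card (Bd \<inter> {..<n}) \<le> 3 * ((n + 1) div K + 1)"
        unfolding Bd_def using q K0 L by (intro card_near_multiples) auto
      then have "real (card (Bd \<inter> {..<n})) \<le> 3 * (real ((n + 1) div K) + 1)"
        unfolding of_nat_le_iff [symmetric, where ?'a = real] of_nat_mult of_nat_add of_nat_1 of_nat_numeral .
      also have "\<dots> \<le> 3 * (real (n + 1) / real K + 1)"
        by (intro mult_left_mono add_right_mono of_nat_div_le_of_nat) auto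
      also have "\<dots> = real (n + 1) * (3 / real K) + 3"
        by (simp add: algebra_simps)
      also have "\<dots> \<le> real (n + 1) * (\<delta> / 8) + 3"
        using K K0 by (intro add_right_mono mult_left_mono) (auto simp: field_simps)
      also have "\<dots> \<le> \<delta> / 4 * real n"
        using elim \<delta> by (simp add: field_simps)
      finally show ?case .
    qed
  qed
  have "density_zero Z"
    unfolding Z_def using D q by (rule density_zero_meeting_windows)
  then have Z_bound: "\<forall>\<^sub>F n in sequentially. real (card (Z \<inter> {..<n})) \<le> \<delta> / 4 * real n"
    using \<delta> unfolding density_zero_def by (elim allE[of _ "\<delta> / 4"]) simp
  have S_bound: "\<delta> / 2 * real n < real (card (S \<inter> {..<n}))"
    if 1: "\<delta> * real n < real (card ({x. A x = s} \<inter> {..<n}))"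
      and 2: "real (card (Bd \<inter> {..<n})) \<le> \<delta> / 4 * real n" "real (card (Z \<inter> {..<n})) \<le> \<delta> / 4 * real n"
    for n
  proof -
    have "card ({x. A x = s} \<inter> {..<n}) \<le> card (S \<inter> {..<n} \<union> (Bd \<inter> {..<n} \<union> Z \<inter> {..<n}))"
      by (intro card_mono) (auto simp: S_def)
    also have "\<dots> \<le> card (S \<inter> {..<n}) + (card (Bd \<inter> {..<n}) + card (Z \<inter> {..<n}))"
      by (meson add_left_mono card_Un_le order_trans)
    finally have "real (card ({x. A x = s} \<inter> {..<n})) \<le>
        real (card (S \<inter> {..<n})) + (real (card (Bd \<inter> {..<n})) + real (card (Z \<inter> {..<n})))"
      by linarith
    with 1 2 show ?thesis
      by (simp add: field_simps)
  qed
  have "\<forall>\<^sub>F n in sequentially. \<delta> * real n < real (card ({x. A x = s} \<inter> {..<n})) \<longrightarrow>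
      \<delta> / 2 * real n < real (card (S \<inter> {..<n}))"
    using Bd_bound Z_bound by eventually_elim (use S_bound in blast)
  then have freqS: "\<exists>\<^sub>F n in sequentially. \<delta> / 2 * real n < real (card (S \<inter> {..<n}))"
    using freq by (rule frequently_mp)
  \<comment> \<open>The number of the L-block containing (x + 2) q; for x outside \<open>Bd\<close>
    it contains the whole double block.\<close>
  define y where "y x = (x + 2) * q div L" for x
  have U': "real (card (range B)) < \<delta> / 2 / 2 * real (U + 1)"
    using U by simp
  have "range (\<lambda>x. B (y x)) \<subseteq> range B" "\<delta> / 2 > 0"
    using \<delta> by auto
  then obtain x u where xS: "x \<in> S" "x + K * u \<in> S" and Beq: "B (y (x + K * u)) = B (y x)"
    and u: "1 \<le> u" "u \<le> U"
    using recurrence_of_coloured_set[OF freqS _ fin _ U' K0] by metis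
  have ug: "u * g \<le> q"
    using u(2) g by (meson le_trans mult_le_mono1)
  define x' where "x' = x + K * u"
  have Ax: "A x = s" "A x' = s"
    using xS by (auto simp: S_def x'_def)
  define R where "R = (x + 2) * q mod L"
  have R: "3 * q \<le> R" "R < L"
    using xS L0 by (auto simp: S_def Bd_def R_def)
  have xq: "(x + 2) * q = y x * L + R"
    by (simp add: y_def R_def)
  \<comment> \<open>Passing from x to x' moves the X-block by u K q = u L - u g, hence the Y-block number by u.\<close>
  have x'q: "(x' + 2) * q = (y x + u) * L + (R - u * g)"
    using xq R(1) ug L by (simp add: x'_def algebra_simps)
  have y': "y x' = y x + u"
    unfolding y_def[of x'] x'q using R L0 by simp
  have ab: "a n = b n" if "x * q \<le> n" "n < x * q + M" for n
  proof -
    have "x \<notin> Z" using xS by (simp add: S_def)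
    then have "\<forall>r<M. a (x * q + r) = b (x * q + r)"
      by (auto simp: Z_def)
    moreover have "n - x * q < M" using that by simp
    ultimately have "a (x * q + (n - x * q)) = b (x * q + (n - x * q))" by blast
    with that show ?thesis by simp
  qed
  \<comment> \<open>The chain goes from x' to x by the state, across to b, forward by u L by the
    colour, and back to a. Only r < 2 q is required; r + u g may leave the double block of
    x'.\<close>
  have shift: "a (x' * q + r + u * g) = a (x' * q + r)" if r: "r < 2 * q" for r
  proof -
    have KuU: "K * u * q \<le> K * U * q"
      using u(2) by simp
    have "a (x' * q + r) = a (x * q + r)"
      using A[of x' x r] Ax r by simp
    also have "\<dots> = b (x * q + r)"
      using r q by (intro ab) (auto simp: M_def algebra_simps)
    also have "x * q + r = y x * L + (R - 2 * q + r)"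
      using xq R(1) by (simp add: algebra_simps)
    also have "b \<dots> = b (y x' * L + (R - 2 * q + r))"
      using R r Beq by (intro B) (auto simp: x'_def)
    also have "y x' * L + (R - 2 * q + r) = x' * q + r + u * g"
      using x'q R(1) ug unfolding y' [symmetric] distrib_right by linarith
    also have "b \<dots> = a \<dots>"
    proof (rule ab [symmetric])
      have "x' * q = x * q + K * u * q" "M = K * U * q + 4 * q"
        by (simp_all add: x'_def M_def algebra_simps)
      then show "x * q \<le> x' * q + r + u * g" "x' * q + r + u * g < x * q + M"
        using KuU r ug q by linarith+
    qed
    finally show ?thesis by simp
  qed
  have zx': "a (z * q + r) = a (x' * q + r)" if "r < 2 * q" for r
    using A[of z x' r] Ax s that by simp
  have step: "a (z * q + (r + u * g)) = a (z * q + r)" if "r + u * g < 2 * q" for r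
    using shift[of r] zx'[of r] zx'[of "r + u * g"] that by (simp add: add.assoc)
  \<comment> \<open>Every u between 1 and U divides \<open>fact U\<close>, so iterating the period u
    g removes the dependence on u.\<close>
  obtain i where i: "(fact U :: nat) = u * i"
    using u dvd_fact[of u U] by (auto elim: dvdE)
  have F: "fact U * g = i * (u * g)"
    unfolding i by simp
  have "a (z * q + (r + i * (u * g))) = a (z * q + r)"
    by (rule period_iterate[where f = "\<lambda>r. a (z * q + r)" and p = "u * g" and N = "2 * q"])
      (use step r F in auto)
  then show ?thesis
    by (simp add: F add.assoc)
qed

text \<open>The essential states fix \<delta>, which fixes K and U, and only then are the two powers
  chosen. The period comes out the same for all essential states, and almost every n has such a
  state at its prefix n div q.\<close>

lemma shift_invariant_ae:
  fixes a b :: "nat \<Rightarrow> 'b" and A :: "nat \<Rightarrow> 's" and B :: "nat \<Rightarrow> 't"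
  assumes kl: "k \<ge> 2" "l \<ge> 2" "multiplicatively_independent k l"
    and A: "digit_states k 2 A a" and B: "digit_states l 1 B b"
    and D: "density_zero {n. a n \<noteq> b n}"
  obtains P where "P > 0" "density_zero {n. a (n + P) \<noteq> a n}"
proof -
  define E where "E = {s \<in> range A. \<not> density_zero {x. A x = s}}"
  have finA: "finite (range A)" and finB: "finite (range B)"
    using A B by (auto simp: digit_states_def)
  have finE: "finite E"
    using finA by (simp add: E_def)
  have "\<And>s. s \<in> E \<Longrightarrow> \<not> density_zero {x. A x = s}"
    by (simp add: E_def)
  then obtain \<delta> :: real where \<delta>: "\<delta> > 0"
    "\<And>s. s \<in> E \<Longrightarrow> \<exists>\<^sub>F n in sequentially. \<delta> * real n < real (card ({x. A x = s} \<inter> {..<n}))"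
    using uniform_density_of_finitely_many[OF finE, of "\<lambda>s. {x. A x = s}"] by metis
  obtain K :: nat where "24 / \<delta> < real K"
    using reals_Archimedean2 by blast
  then have K: "24 \<le> \<delta> * real K"
    using \<delta>(1) by (simp add: field_simps)
  then have K0: "K > 0"
    by (cases K) auto
  obtain U :: nat where "4 * real (card (range B)) / \<delta> < real U"
    using reals_Archimedean2 by blast
  then have U: "real (card (range B)) < \<delta> / 4 * real (U + 1)"
    using \<delta>(1) by (simp add: field_simps)
  \<comment> \<open>The strict lower bound makes g, hence the period, positive. The upper bound
    gives \<open>fact U * g < q\<close>, so a shift from the first half of a double block stays
    inside it.\<close>
  obtain m j where mj: "real K * real k ^ m < real l ^ j" "real l ^ j < (real K + 1 / fact U) * real k ^ m"
    using power_ratio_dense[OF kl, of "real K" "real K + 1 / fact U" 0] K0 by auto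
  define q where "q = k ^ m"
  define L where "L = l ^ j"
  have q: "q > 0"
    using kl by (simp add: q_def)
  have "real (K * q) < real L"
    using mj(1) by (simp add: q_def L_def)
  then have KqL: "K * q < L"
    using of_nat_less_iff by blast
  define g where "g = L - K * q"
  have g: "L = K * q + g" "g > 0"
    using KqL by (auto simp: g_def)
  have "real (fact U * g) < real q"
  proof -
    have "real L < (real K + 1 / fact U) * real q"
      using mj(2) by (simp add: q_def L_def)
    then have "real g < real q / fact U"
      unfolding g(1) by (simp add: field_simps)
    then show ?thesis
      by (simp add: field_simps)
  qed
  then have P: "fact U * g < q"
    using of_nat_less_iff by blast
  have Ug: "U * g \<le> q"
    using P fact_ge_self[of U] by (meson le_trans less_imp_le mult_le_mono1)
  have "a (n + fact U * g) = a n" if "A (n div q) \<in> E" for n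
  proof -
    have "a (n div q * q + n mod q + fact U * g) = a (n div q * q + n mod q)"
    proof (rule local_period[OF _ _ finB U g(1) Ug q K D \<delta>(1) \<delta>(2)[OF that] refl])
      show "a (x * q + r) = a (x' * q + r)" if "A x = A x'" "r < 2 * q" for x x' r
        unfolding q_def by (rule digit_statesD[OF A that(1)]) (use that(2) in \<open>simp add: q_def\<close>)
      show "b (y * L + r) = b (y' * L + r)" if "B y = B y'" "r < L" for y y' r
        unfolding L_def by (rule digit_statesD[OF B that(1)]) (use that(2) in \<open>simp add: L_def\<close>)
      have "n mod q < q"
        using q by simp
      with P show "n mod q + fact U * g < 2 * q"
        by linarith
    qed
    then show ?thesis by simp
  qed
  then have "{n. a (n + fact U * g) \<noteq> a n} \<subseteq> (\<Union>s\<in>range A - E. {n. n div q \<in> {x. A x = s}})"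
    by auto
  moreover have "density_zero (\<Union>s\<in>range A - E. {n. n div q \<in> {x. A x = s}})"
    using finA q by (intro density_zero_UN density_zero_div_vimage) (auto simp: E_def)
  ultimately have "density_zero {n. a (n + fact U * g) \<noteq> a n}"
    using density_zero_subset by blast
  with g(2) show thesis
    by (intro that[of "fact U * g"]) auto
qed

section \<open>From local to global periods\<close>

text \<open>Each cylinder of x has a constant value, but that value may still vary with m.\<close>

definition flat :: "nat \<Rightarrow> (nat \<Rightarrow> 'b) \<Rightarrow> nat \<Rightarrow> bool" where
  "flat k a x \<longleftrightarrow> (\<forall>m r. r < k ^ m \<longrightarrow> a (x * k ^ m + r) = a (x * k ^ m))"

text \<open>A jump inside a cylinder of x recurs at the same offset for every z with the state of x.
  Jumps have density zero, so this state is negligible, and there are finitely many states.\<close>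

lemma flat_ae:
  fixes a :: "nat \<Rightarrow> 'b" and A :: "nat \<Rightarrow> 's"
  assumes k: "k \<ge> 2" and A: "digit_states k 1 A a" and const: "density_zero {n. a (n + 1) \<noteq> a n}"
  shows "density_zero {x. \<not> flat k a x}"
proof -
  have flatI: "flat k a x" if x: "\<not> density_zero {z. A z = A x}" for x
  proof -
    have step: "a (x * k ^ m + Suc r) = a (x * k ^ m + r)" if r: "Suc r < k ^ m" for m r
    proof (rule ccontr)
      assume neq: "a (x * k ^ m + Suc r) \<noteq> a (x * k ^ m + r)"
      have "a (z * k ^ m + r + 1) \<noteq> a (z * k ^ m + r)" if "A z = A x" for z
      proof -
        have "a (z * k ^ m + Suc r) = a (x * k ^ m + Suc r)" "a (z * k ^ m + r) = a (x * k ^ m + r)"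
          by (rule digit_statesD[OF A that], use r in simp)+
        with neq show ?thesis by simp
      qed
      then have "{z. A z = A x} \<subseteq> {z. z * k ^ m + r \<in> {n. a (n + 1) \<noteq> a n}}"
        by auto
      moreover have "density_zero {z. z * k ^ m + r \<in> {n. a (n + 1) \<noteq> a n}}"
        using const k by (intro density_zero_affine_vimage) auto
      ultimately show False
        using x density_zero_subset by blast
    qed
    have "a (x * k ^ m + r) = a (x * k ^ m)" if "r < k ^ m" for r m
      using that
    proof (induction r)
      case (Suc r)
      then show ?case using step[of r m] by simp
    qed simp
    then show ?thesis by (auto simp: flat_def)
  qed
  have "density_zero (\<Union>s\<in>{s \<in> range A. density_zero {z. A z = s}}. {z. A z = s})"
    using A by (intro density_zero_UN) (auto simp: digit_states_def)
  moreover have "{x. \<not> flat k a x} \<subseteq> (\<Union>s\<in>{s \<in> range A. density_zero {z. A z = s}}. {z. A z = s})"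
    using flatI by auto
  ultimately show ?thesis
    using density_zero_subset by blast
qed

text \<open>Two of the states of x k^i with i \<le> card (range A) coincide, so the value at x k^t
  is eventually periodic in t. The factor in X skips the preperiod, and e is the period.\<close>

lemma flat_constant_along_powers:
  fixes a :: "nat \<Rightarrow> 'b" and A :: "nat \<Rightarrow> 's"
  assumes k: "k \<ge> 2" and A: "digit_states k 1 A a" and x: "flat k a x"
  defines "X \<equiv> x * k ^ card (range A)"
  obtains e where "e > 0" "\<And>u r. r < (k ^ e) ^ u \<Longrightarrow> a (X * (k ^ e) ^ u + r) = a X"
proof -
  define T where "T = card (range A)"
  have "\<not> inj_on (\<lambda>i. A (x * k ^ i)) {..T}"
  proof
    assume "inj_on (\<lambda>i. A (x * k ^ i)) {..T}"
    then have "card {..T} \<le> card (range A)"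
      using A by (intro card_inj_on_le) (auto simp: digit_states_def)
    then show False by (simp add: T_def)
  qed
  then obtain i i' where i: "i < i'" "i' \<le> T" "A (x * k ^ i) = A (x * k ^ i')"
    unfolding inj_on_def by (metis atMost_iff linorder_neqE_nat)
  define e where "e = i' - i"
  have per: "a (x * k ^ (t + e)) = a (x * k ^ t)" if "t \<ge> i" for t
  proof -
    have "a (x * k ^ i * k ^ (t - i) + 0) = a (x * k ^ i' * k ^ (t - i) + 0)"
      using k by (intro digit_statesD[OF A i(3)]) simp
    moreover have "t + e = i' + (t - i)" "t = i + (t - i)"
      using i(1) that by (auto simp: e_def)
    ultimately show ?thesis
      by (metis add_0_right mult.assoc power_add)
  qed
  have pow: "a (x * k ^ (T + e * u)) = a X" for u
  proof (induction u)
    case (Suc u)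
    then show ?case
      using per[of "T + e * u"] i by (simp add: algebra_simps)
  qed (simp add: X_def T_def)
  have "a (X * (k ^ e) ^ u + r) = a X" if "r < (k ^ e) ^ u" for u r
  proof -
    have eq: "X * (k ^ e) ^ u = x * k ^ (T + e * u)"
      by (simp add: X_def T_def power_add power_mult)
    \<comment> \<open>The cylinder of X at level e u is an initial piece of the flat cylinder of x
      at level T + e u.\<close>
    have "r < k ^ (e * u)"
      using that by (simp add: power_mult)
    also have "\<dots> \<le> k ^ (T + e * u)"
      using k by (intro power_increasing) auto
    finally show ?thesis
      using x pow[of u] unfolding eq flat_def by simp
  qed
  then show thesis
    using i(1) by (intro that[of e]) (auto simp: e_def)
qed

text \<open>Powers q of k and L of l are chosen with y L between x q and (x + 1/2) q. The cylinders
  of x and y then overlap in a fixed proportion of (x + 1) q; if v \<noteq> w, this overlap would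
  consist of disagreements.\<close>

lemma cylinder_values_agree:
  fixes a b :: "nat \<Rightarrow> 'b"
  assumes kl: "k \<ge> 2" "l \<ge> 2" "multiplicatively_independent k l"
    and D: "density_zero {n. a n \<noteq> b n}" and xy: "x > 0" "y > 0"
    and a: "\<And>m r. r < k ^ m \<Longrightarrow> a (x * k ^ m + r) = v"
    and b: "\<And>j r. r < l ^ j \<Longrightarrow> b (y * l ^ j + r) = w"
  shows "v = w"
proof (rule ccontr)
  assume "v \<noteq> w"
  \<comment> \<open>Calibrated to give h \<le> q / 4 and h \<le> q / (2 y). The first contradicts an
    overlap ending at (x + 1) q, which is longer than q / 2; the second contradicts h = L, as L > x
    q / y.\<close>
  define \<epsilon> where "\<epsilon> = min (1 / 4) (1 / (2 * real y)) / real (x + 1)"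
  have "\<epsilon> > 0"
    using xy by (simp add: \<epsilon>_def)
  with D obtain N where N: "\<And>n. n \<ge> N \<Longrightarrow> real (card ({n. a n \<noteq> b n} \<inter> {..<n})) \<le> \<epsilon> * real n"
    by (auto simp: density_zero_def eventually_at_top_linorder)
  obtain m j where mj: "m \<ge> N" "real x / real y * real k ^ m < real l ^ j"
    "real l ^ j < (real x + 1 / 2) / real y * real k ^ m"
    by (rule power_ratio_dense[OF kl, of "real x / real y" "(real x + 1 / 2) / real y" N])
      (use xy in \<open>auto simp: divide_strict_right_mono\<close>)
  define q where "q = k ^ m"
  define L where "L = l ^ j"
  have "real (x * q) < real (y * L)" and up: "real (2 * (y * L)) < real ((2 * x + 1) * q)"
    using mj(2,3) xy by (auto simp: q_def L_def field_simps)
  then have lo': "x * q < y * L" and up': "2 * (y * L) < (2 * x + 1) * q"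
    using of_nat_less_iff by blast+
  define h where "h = min L ((x + 1) * q - y * L)"
  have "q > 0" using kl by (simp add: q_def)
  have end_le: "y * L + h \<le> (x + 1) * q"
    using up' by (auto simp: h_def)
  \<comment> \<open>On this common part of the two cylinders a has value v and b has value w.\<close>
  have "{y * L..<y * L + h} \<subseteq> {n. a n \<noteq> b n} \<inter> {..<(x + 1) * q}"
  proof
    fix n assume n: "n \<in> {y * L..<y * L + h}"
    then have "b (y * L + (n - y * L)) = w"
      unfolding L_def by (intro b) (auto simp: h_def L_def)
    moreover have "a (x * q + (n - x * q)) = v"
      unfolding q_def by (intro a) (use n lo' end_le in \<open>auto simp: q_def\<close>)
    ultimately show "n \<in> {n. a n \<noteq> b n} \<inter> {..<(x + 1) * q}"
      using n lo' end_le \<open>v \<noteq> w\<close> by simp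
  qed
  then have "card {y * L..<y * L + h} \<le> card ({n. a n \<noteq> b n} \<inter> {..<(x + 1) * q})"
    by (intro card_mono) auto
  then have "real h \<le> real (card ({n. a n \<noteq> b n} \<inter> {..<(x + 1) * q}))"
    by simp
  also have "m < k ^ m"
    using kl(1) by (intro power_gt_expt) auto
  then have "N \<le> (x + 1) * q"
    using mj(1) by (simp add: q_def)
  then have "real (card ({n. a n \<noteq> b n} \<inter> {..<(x + 1) * q})) \<le> \<epsilon> * real ((x + 1) * q)"
    by (rule N)
  also have "\<dots> = min (1 / 4) (1 / (2 * real y)) * real q"
    unfolding \<epsilon>_def of_nat_mult by (simp del: of_nat_add of_nat_Suc)
  finally have h_le: "real h \<le> min (1 / 4) (1 / (2 * real y)) * real q" .
  have "real h \<le> 1 / 4 * real q" "real h \<le> 1 / (2 * real y) * real q"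
    by (rule order_trans[OF h_le], rule mult_right_mono, simp, simp)+
  then have "4 * real h \<le> real q" "2 * real y * real h \<le> real q"
    using xy by (simp_all add: field_simps)
  then have "real (4 * h) \<le> real q" "real (2 * y * h) \<le> real q"
    by simp_all
  then have h4: "4 * h \<le> q" and hy: "2 * y * h \<le> q"
    using of_nat_le_iff by blast+
  show False
  proof (cases "h = L")
    case True
    have "q \<le> x * q"
      using xy by simp
    moreover have "2 * (y * L) \<le> q"
      using hy True by (simp only: mult.assoc)
    ultimately show False
      using lo' \<open>q > 0\<close> by linarith
  next
    case False
    then have "h = (x + 1) * q - y * L"
      by (simp add: h_def min_def split: if_splits)
    then show False
      using h4 up' \<open>q > 0\<close> by (simp add: algebra_simps)
  qed
qed

text \<open>The quotient of logarithms changes only by the rational factor e / f.\<close>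

lemma multiplicatively_independent_power:
  assumes "multiplicatively_independent k l" "k \<ge> 2" "l \<ge> 2" "e > 0" "f > 0"
  shows "multiplicatively_independent (k ^ e) (l ^ f)"
  unfolding multiplicatively_independent_def
proof
  have "ln (real k) / ln (real l) = real f / real e * (ln (real (k ^ e)) / ln (real (l ^ f)))"
    using assms by (simp add: ln_realpow)
  moreover assume "ln (real (k ^ e)) / ln (real (l ^ f)) \<in> \<rat>"
  then have "real f / real e * (ln (real (k ^ e)) / ln (real (l ^ f))) \<in> \<rat>"
    by (intro Rats_mult) (auto intro: Rats_divide)
  ultimately show False
    using assms(1) by (simp add: multiplicatively_independent_def)
qed

text \<open>One flat y for b supplies the reference value \<open>b Y\<close>. Each flat prefix x of
  a is compared with it in the bases k^e and l^f, where e depends on x; flat prefixes account for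
  almost every n.\<close>

lemma shift_invariant_imp_constant_ae:
  fixes a b :: "nat \<Rightarrow> 'b" and A :: "nat \<Rightarrow> 's" and B :: "nat \<Rightarrow> 't"
  assumes kl: "k \<ge> 2" "l \<ge> 2" "multiplicatively_independent k l"
    and A: "digit_states k 1 A a" and B: "digit_states l 1 B b"
    and D: "density_zero {n. a n \<noteq> b n}" and inv: "density_zero {n. a (n + 1) \<noteq> a n}"
  obtains w where "density_zero {n. a n \<noteq> w}"
proof -
  \<comment> \<open>If b changes between n and n + 1, then a does so too, or a and b differ at n or
    at n + 1.\<close>
  have "density_zero ({n. a (n + 1) \<noteq> a n} \<union> {n. a n \<noteq> b n} \<union> {n. n * 1 + 1 \<in> {n. a n \<noteq> b n}})"
    using D inv by (intro density_zero_Un density_zero_affine_vimage) auto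
  then have "density_zero {n. b (n + 1) \<noteq> b n}"
    by (rule density_zero_subset) auto
  \<comment> \<open>Adding \<open>{..<1}\<close> excludes y = 0, since the comparison of cylinders
    needs positive prefixes.\<close>
  then have "density_zero ({y. \<not> flat l b y} \<union> {..<1})"
    using flat_ae[OF kl(2) B] by (intro density_zero_Un density_zero_lessThan)
  moreover have "\<not> density_zero (UNIV :: nat set)"
  proof
    assume "density_zero (UNIV :: nat set)"
    then have "\<forall>\<^sub>F n in sequentially. real n \<le> 1 / 2 * real n"
      unfolding density_zero_def by (elim allE[of _ "1 / 2"]) simp
    then obtain N where "\<And>n. n \<ge> N \<Longrightarrow> real n \<le> 1 / 2 * real n"
      by (auto simp: eventually_at_top_linorder)
    from this[of "Suc N"] show False by simp
  qed
  ultimately obtain y where y: "flat l b y" "y > 0"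
    by (metis (mono_tags, lifting) UNIV_eq_I Un_iff lessThan_iff less_one mem_Collect_eq not_gr_zero)
  define Y where "Y = y * l ^ card (range B)"
  obtain f where f: "f > 0" "\<And>u r. r < (l ^ f) ^ u \<Longrightarrow> b (Y * (l ^ f) ^ u + r) = b Y"
    unfolding Y_def using flat_constant_along_powers[OF kl(2) B y(1)] by blast
  have Y0: "Y > 0"
    using y(2) kl(2) by (simp add: Y_def)
  have ge2: "c ^ i \<ge> 2" if "c \<ge> 2" "i > 0" for c i :: nat
    using that self_le_power[of c i] by linarith
  define Q where "Q = k ^ card (range A)"
  have Q0: "Q > 0"
    using kl(1) by (simp add: Q_def)
  have val: "a (x * Q + r) = b Y" if x: "flat k a x" "x > 0" and r: "r < Q" for x r
  proof -
    obtain e where e: "e > 0" "\<And>u r. r < (k ^ e) ^ u \<Longrightarrow> a (x * Q * (k ^ e) ^ u + r) = a (x * Q)"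
      unfolding Q_def using flat_constant_along_powers[OF kl(1) A x(1)] by blast
    have "a (x * Q + r) = a (x * Q)"
      using x(1) r by (simp add: flat_def Q_def)
    also have "\<dots> = b Y"
      using cylinder_values_agree[of "k ^ e" "l ^ f" a b "x * Q" Y] kl e f D x(2) Q0 Y0 ge2
        multiplicatively_independent_power by auto
    finally show ?thesis .
  qed
  have "a n = b Y" if "n div Q \<notin> {x. \<not> flat k a x} \<union> {..<1}" for n
    using val[of "n div Q" "n mod Q"] that Q0 by auto
  then have "{n. a n \<noteq> b Y} \<subseteq> {n. n div Q \<in> {x. \<not> flat k a x} \<union> {..<1}}"
    by blast
  moreover have "density_zero {n. n div Q \<in> {x. \<not> flat k a x} \<union> {..<1}}"
    using flat_ae[OF kl(1) A inv] Q0 by (intro density_zero_div_vimage density_zero_Un density_zero_lessThan)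
  ultimately show thesis
    using density_zero_subset that by blast
qed

theorem mainTheorem1:
  fixes k l :: nat and a b :: "nat \<Rightarrow> 'b"
  assumes "k \<ge> 2" and "l \<ge> 2"
    and "multiplicatively_independent k l"
    and "automatic k a" and "automatic l b"
    and "coincide_ae a b"
  shows "periodic_ae a \<and> periodic_ae b"
proof -
  have D: "density_zero {n. a n \<noteq> b n}"
    using assms(6) by (simp add: coincide_ae_iff)
  obtain A :: "nat \<Rightarrow> nat option" where A: "digit_states k 1 A a"
    using automatic_digit_states assms(1,4) by blast
  obtain B :: "nat \<Rightarrow> nat option" where B: "digit_states l 1 B b"
    using automatic_digit_states assms(2,5) by blast
  obtain P where P: "P > 0" "density_zero {n. a (n + P) \<noteq> a n}"
    using shift_invariant_ae[OF assms(1-3) digit_states_two_blocks[OF A] B D] by blast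
  \<comment> \<open>Words of length P turn almost invariance under the shift by P into almost
    invariance under the shift by 1.\<close>
  define block :: "(nat \<Rightarrow> 'b) \<Rightarrow> nat \<Rightarrow> 'b list"
    where "block f n = map (\<lambda>i. f (n * P + i)) [0..<P]" for f n
  have "{n. block a n \<noteq> block b n} \<subseteq> {n. \<exists>i<P. n * P + i \<in> {n. a n \<noteq> b n}}"
    by (auto simp: block_def)
  then have D': "density_zero {n. block a n \<noteq> block b n}"
    using density_zero_meeting_windows[OF D P(1)] density_zero_subset by blast
  have "{n. block a (n + 1) \<noteq> block a n} \<subseteq> {n. \<exists>i<P. n * P + i \<in> {n. a (n + P) \<noteq> a n}}"
    by (auto simp: block_def algebra_simps)
  then have inv: "density_zero {n. block a (n + 1) \<noteq> block a n}"
    using density_zero_meeting_windows[OF P(2) P(1)] density_zero_subset by blast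
  have A': "digit_states k 1 (\<lambda>x. map (\<lambda>i. A (x * P + i)) [0..<P]) (block a)"
    unfolding block_def by (rule digit_states_blocking[OF A]) (use assms(1) in simp)
  have B': "digit_states l 1 (\<lambda>x. map (\<lambda>i. B (x * P + i)) [0..<P]) (block b)"
    unfolding block_def by (rule digit_states_blocking[OF B]) (use assms(2) in simp)
  obtain w where w: "density_zero {n. block a n \<noteq> w}"
    using shift_invariant_imp_constant_ae[OF assms(1-3) A' B' D' inv] by blast
  \<comment> \<open>Wherever the word at n div P is w, its entry at n mod P is a n.\<close>
  define c where "c n = w ! (n mod P)" for n
  have "periodic c"
    using P(1) by (auto simp: periodic_def c_def)
  have "a n = c n" if w: "block a (n div P) = w" for n
    unfolding c_def w [symmetric] block_def using P(1) by simp
  then have "{n. a n \<noteq> c n} \<subseteq> {n. n div P \<in> {n. block a n \<noteq> w}}"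
    by auto
  then have ac: "density_zero {n. a n \<noteq> c n}"
    using density_zero_div_vimage[OF w P(1)] density_zero_subset by blast
  have "density_zero {n. b n \<noteq> c n}"
    by (rule density_zero_subset[OF density_zero_Un[OF D ac]]) auto
  with ac \<open>periodic c\<close> show ?thesis
    unfolding periodic_ae_def coincide_ae_iff by blast
qed

end
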